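(* Let $f:[0,1]\to[0,1]$ be a continuous map such that $\bigcap_{i=0}^\infty f^i([0,1])$ is not a singleton. If $f$ is piecewise monotone, then $$\Lambda(f)=\exp h(f),$$ where $h(f)$ denotes the topological entropy of $f$.
   Context: For a continuous map $f:[0,1]\to[0,1]$, $\Lambda(f)$ is the infimum of all real $\lambda$ such that for some homeomorphism $\psi:[0,1]\to[0,1]$ the map $g=\psi\circ f\circ\psi^{-1}$ has Lipschitz constant $\lambda$, i.e. $|g(x)-g(y)|\le\lambda|x-y|$ for all $x,y\in[0,1]$ (the infimum of the empty set is $\infty$). Piecewise monotone means that there are finitely many points $0=c_0<c_1<\dots<c_k=1$ such that $f$ is monotone (not necessarily strictly) on each $[c_{i-1},c_i]$. *)

theory Defs
  imports "HOL-Analysis.Analysis"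
begin

text \<open>Topological entropy in the form due to Bowen and Dinaburg: a set is \<open>(n, \<epsilon>)\<close>-separated if
  any two of its distinct points are more than \<open>\<epsilon>\<close> apart at some time \<open>i < n\<close>.\<close>

definition separated_set :: "('a::metric_space \<Rightarrow> 'a) \<Rightarrow> nat \<Rightarrow> real \<Rightarrow> 'a set \<Rightarrow> bool" where
  "separated_set f n \<epsilon> E \<longleftrightarrow>
     (\<forall>x\<in>E. \<forall>y\<in>E. x \<noteq> y \<longrightarrow> (\<exists>i<n. dist ((f ^^ i) x) ((f ^^ i) y) > \<epsilon>))"

text \<open>The supremum below is \<open>(1/n) log s(n, \<epsilon>)\<close>, where \<open>s(n, \<epsilon>)\<close> is the maximal cardinality of an
  \<open>(n, \<epsilon>)\<close>-separated subset of \<open>X\<close>; taking it in \<^typ>\<open>ereal\<close> rather than first forming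
  \<open>s(n, \<epsilon>)\<close> gives \<open>\<infinity>\<close>, not a junk value, if the cardinalities are unbounded.\<close>

definition separation_rate :: "('a::metric_space \<Rightarrow> 'a) \<Rightarrow> 'a set \<Rightarrow> real \<Rightarrow> ereal" where
  "separation_rate f X \<epsilon> =
     limsup (\<lambda>n. SUP E\<in>{E. finite E \<and> E \<noteq> {} \<and> E \<subseteq> X \<and> separated_set f n \<epsilon> E}.
       ereal (ln (real (card E)) / real n))"

text \<open>The rate is nonincreasing in \<open>\<epsilon>\<close>, so its limit as \<open>\<epsilon>\<close> decreases to 0 is the supremum.
  The definition is meant for nonempty compact \<open>X\<close> and continuous \<open>f\<close> mapping \<open>X\<close> into itself.\<close>

definition topological_entropy :: "('a::metric_space \<Rightarrow> 'a) \<Rightarrow> 'a set \<Rightarrow> ereal" where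
  "topological_entropy f X = (SUP \<epsilon>\<in>{0<..}. separation_rate f X \<epsilon>)"

fun exp_ereal :: "ereal \<Rightarrow> ereal" where
  "exp_ereal (ereal r) = ereal (exp r)"
| "exp_ereal PInfty = \<infinity>"
| "exp_ereal MInfty = 0"

text \<open>The second map of a library \<^const>\<open>homeomorphism\<close> is the inverse of the first.  The condition
  \<open>0 \<le> L\<close> built into \<^const>\<open>lipschitz_on\<close> is automatic on an interval with two points.  The infimum
  of the empty set is \<open>\<infinity>\<close>.\<close>

definition conj_lipschitz_inf :: "(real \<Rightarrow> real) \<Rightarrow> ereal" where
  "conj_lipschitz_inf f =
     Inf (ereal ` {L. \<exists>(\<psi>::real \<Rightarrow> real) \<psi>'. homeomorphism {0..1} {0..1} \<psi> \<psi>' \<and>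
                             L-lipschitz_on {0..1} (\<psi> \<circ> f \<circ> \<psi>')})"

definition piecewise_monotone :: "(real \<Rightarrow> real) \<Rightarrow> bool" where
  "piecewise_monotone f \<longleftrightarrow>
     (\<exists>(k::nat) (c::nat \<Rightarrow> real). c 0 = 0 \<and> c k = 1 \<and> (\<forall>i<k. c i < c (Suc i)) \<and>
       (\<forall>i<k. mono_on {c i..c (Suc i)} f \<or> antimono_on {c i..c (Suc i)} f))"

end

theory Submission
  imports Defs
begin

text \<open>An \<open>L\<close>-Lipschitz interval map with \<open>L \<ge> 1\<close> has entropy at most \<open>ln L\<close>, and entropy is a
  conjugacy invariant; for \<open>L < 1\<close> the conjugate would be a contraction, whose core is a single
  point.  This gives one inequality.

  For the other one take \<open>L > exp h\<close> and let \<open>v n x\<close> be the variation of \<open>f ^^ n\<close> on \<open>[0, x]\<close>.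
  If \<open>v n 1\<close> grows more slowly than \<open>L ^ n\<close>, the series \<open>\<Sum>n. v n x / L ^ n\<close> converges to a continuous
  strictly increasing function, and as \<open>v n\<close> varies between \<open>f x\<close> and \<open>f y\<close> by at most
  \<open>v (n + 1) y - v (n + 1) x\<close>, it conjugates \<open>f\<close> (after normalisation) to an \<open>L\<close>-Lipschitz map.
  The growth bound is that of Misiurewicz and Szlenk: \<open>v n\<close> varies by at most 1 on points with the same
  \<open>n\<close>-step itinerary through the monotone pieces, and the number of itineraries is bounded by the
  cardinality of separated sets up to a subexponential factor.\<close>

section \<open>Lipschitz conjugates and entropy\<close>

lemma card_separated_unit_interval:
  fixes E :: "real set"
  assumes "finite E" "E \<subseteq> {0..1}" "d > 0"
    and sep: "\<And>x y. x \<in> E \<Longrightarrow> y \<in> E \<Longrightarrow> x \<noteq> y \<Longrightarrow> d < dist x y"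
  shows "real (card E) \<le> 1 / d + 1"
proof -
  have inj: "inj_on (\<lambda>x. \<lfloor>x / d\<rfloor>) E"
  proof (rule inj_onI, rule ccontr)
    fix x y assume "x \<in> E" "y \<in> E" and eq: "\<lfloor>x / d\<rfloor> = \<lfloor>y / d\<rfloor>" and "x \<noteq> y"
    then have "d < \<bar>x - y\<bar>"
      using sep by (simp add: dist_real_def)
    moreover have "\<bar>x / d - y / d\<bar> < 1"
      using eq by linarith
    then have "\<bar>x - y\<bar> / d < 1"
      using \<open>d > 0\<close> by (simp flip: diff_divide_distrib)
    ultimately show False
      using \<open>d > 0\<close> by (simp add: divide_simps)
  qed
  have "0 \<le> x \<and> x \<le> 1" if "x \<in> E" for x
    using that assms(2) by force
  then have "(\<lambda>x. \<lfloor>x / d\<rfloor>) ` E \<subseteq> {0..\<lfloor>1 / d\<rfloor>}"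
    using \<open>d > 0\<close> by (auto intro!: floor_mono divide_right_mono)
  then have "card E \<le> card {0..\<lfloor>1 / d\<rfloor>}"
    using inj by (metis card_image card_mono finite_atLeastAtMost_int)
  then have "real (card E) \<le> real (nat (\<lfloor>1 / d\<rfloor> + 1))"
    by simp
  also have "\<dots> \<le> 1 / d + 1"
    using \<open>d > 0\<close> by (simp add: nat_add_distrib)
  finally show ?thesis .
qed

lemma funpow_image_subset: "f ` X \<subseteq> X \<Longrightarrow> x \<in> X \<Longrightarrow> (f ^^ n) x \<in> X"
  by (induction n) auto

lemma dist_funpow_lipschitz:
  assumes "L-lipschitz_on X g" "g ` X \<subseteq> X" "x \<in> X" "y \<in> X"
  shows "dist ((g ^^ n) x) ((g ^^ n) y) \<le> L ^ n * dist x y"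
proof (induction n)
  case (Suc n)
  have "dist ((g ^^ Suc n) x) ((g ^^ Suc n) y) \<le> L * dist ((g ^^ n) x) ((g ^^ n) y)"
    using lipschitz_onD[OF assms(1)] funpow_image_subset[OF assms(2)] assms(3,4) by simp
  also have "\<dots> \<le> L * (L ^ n * dist x y)"
    using Suc lipschitz_on_nonneg[OF assms(1)] by (rule mult_left_mono)
  finally show ?case by (simp add: mult.assoc)
qed simp

lemma conjugate_funpow:
  assumes "homeomorphism X X \<psi> \<psi>'" "f ` X \<subseteq> X" "x \<in> X"
  shows "((\<psi> \<circ> f \<circ> \<psi>') ^^ n) (\<psi> x) = \<psi> ((f ^^ n) x)"
  using assms funpow_image_subset[OF assms(2,3)]
  by (induction n) (auto simp: homeomorphism_def)

lemma conjugate_image_subset: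
  assumes "homeomorphism X X \<psi> \<psi>'" "f ` X \<subseteq> X"
  shows "(\<psi> \<circ> f \<circ> \<psi>') ` X \<subseteq> X"
  using assms unfolding homeomorphism_def image_comp[symmetric] by blast

lemma topological_entropy_le_ln_lipschitz:
  fixes f \<psi> \<psi>' :: "real \<Rightarrow> real"
  assumes hom: "homeomorphism {0..1} {0..1} \<psi> \<psi>'"
    and lip: "L-lipschitz_on {0..1} (\<psi> \<circ> f \<circ> \<psi>')"
    and maps: "f ` {0..1} \<subseteq> {0..1}" and "1 \<le> L"
  shows "topological_entropy f {0..1} \<le> ereal (ln L)"
  unfolding topological_entropy_def
proof (rule SUP_least)
  fix \<epsilon> :: real assume "\<epsilon> \<in> {0<..}"
  then have "\<epsilon> > 0" by simp
  have "uniformly_continuous_on {0..1} \<psi>'"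
    using hom compact_uniformly_continuous unfolding homeomorphism_def by blast
  then obtain \<delta> where "\<delta> > 0"
    and \<delta>: "\<And>x y. x \<in> {0..1} \<Longrightarrow> y \<in> {0..1} \<Longrightarrow> dist y x < \<delta> \<Longrightarrow> dist (\<psi>' y) (\<psi>' x) < \<epsilon>"
    using \<open>\<epsilon> > 0\<close> unfolding uniformly_continuous_on_def by metis
  define d where "d = \<delta> / 2"
  have "d > 0" using \<open>\<delta> > 0\<close> by (simp add: d_def)
  have psi_in: "\<psi> x \<in> {0..1}" if "x \<in> {0..1}" for x
    using hom that unfolding homeomorphism_def by blast
  have psi_inv: "\<psi>' (\<psi> x) = x" if "x \<in> {0..1}" for x
    using hom that unfolding homeomorphism_def by blast
  have far: "d < dist (\<psi> x) (\<psi> y)" if "x \<in> {0..1}" "y \<in> {0..1}" "dist x y > \<epsilon>" for x y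
  proof (rule ccontr)
    assume "\<not> d < dist (\<psi> x) (\<psi> y)"
    then have "dist (\<psi> x) (\<psi> y) < \<delta>" using \<open>\<delta> > 0\<close> by (simp add: d_def)
    then have "dist (\<psi>' (\<psi> x)) (\<psi>' (\<psi> y)) < \<epsilon>" using \<delta> psi_in that by blast
    then show False using that by (simp add: psi_inv)
  qed
  define b where "b = 1 / d + 1"
  have "b > 0" using \<open>d > 0\<close> by (simp add: b_def add_pos_pos)
  have bound: "ln (real (card E)) / real n \<le> ln L + ln b / real n"
    if n: "n > 0" and E: "finite E" "E \<noteq> {}" "E \<subseteq> {0..1}" "separated_set f n \<epsilon> E" for n E
  proof -
    have "L > 0" "L ^ n > 0" "1 \<le> L ^ n" using \<open>1 \<le> L\<close> by auto
    have sep: "d / L ^ n < dist (\<psi> x) (\<psi> y)" if xy: "x \<in> E" "y \<in> E" "x \<noteq> y" for x y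
    proof -
      obtain i where i: "i < n" "dist ((f ^^ i) x) ((f ^^ i) y) > \<epsilon>"
        using E(4) xy unfolding separated_set_def by blast
      have xy01: "x \<in> {0..1}" "y \<in> {0..1}" using xy E(3) by auto
      have "d < dist (\<psi> ((f ^^ i) x)) (\<psi> ((f ^^ i) y))"
        using far i(2) xy01 funpow_image_subset[OF maps] by blast
      also have "\<dots> \<le> L ^ i * dist (\<psi> x) (\<psi> y)"
        using dist_funpow_lipschitz[OF lip conjugate_image_subset[OF hom maps]] psi_in xy01
        by (simp only: conjugate_funpow[OF hom maps, symmetric])
      also have "\<dots> \<le> L ^ n * dist (\<psi> x) (\<psi> y)"
        using i(1) \<open>1 \<le> L\<close> by (intro mult_right_mono power_increasing) auto
      finally show ?thesis using \<open>L ^ n > 0\<close> by (simp add: divide_simps mult.commute)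
    qed
    have "inj_on \<psi> E" using psi_inv E(3) by (metis inj_onI subsetD)
    moreover have "real (card (\<psi> ` E)) \<le> 1 / (d / L ^ n) + 1"
      using E(1,3) psi_in \<open>d > 0\<close> \<open>L ^ n > 0\<close> sep
      by (intro card_separated_unit_interval) auto
    ultimately have "real (card E) \<le> L ^ n / d + 1" by (simp add: card_image)
    also have "\<dots> \<le> L ^ n * b"
      using \<open>1 \<le> L ^ n\<close> by (simp add: b_def algebra_simps)
    finally have "real (card E) \<le> L ^ n * b" .
    moreover have "0 < real (card E)" using E(1,2) by (simp add: card_gt_0_iff)
    ultimately have "ln (real (card E)) \<le> ln (L ^ n * b)" using \<open>L ^ n > 0\<close> \<open>b > 0\<close> by simp
    also have "\<dots> = real n * ln L + ln b"
      using \<open>L > 0\<close> \<open>b > 0\<close> by (simp add: ln_mult ln_realpow)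
    finally show ?thesis using n by (simp add: divide_simps mult.commute)
  qed
  have "separation_rate f {0..1} \<epsilon> \<le> limsup (\<lambda>n. ereal (ln L + ln b / real n))"
    unfolding separation_rate_def
    by (rule Limsup_mono)
      (auto simp: eventually_sequentially intro!: exI[of _ 1] SUP_least bound)
  also have "(\<lambda>n. ln L + ln b / real n) \<longlonglongrightarrow> ln L + 0"
    by (intro tendsto_intros tendsto_divide_0[OF tendsto_const] filterlim_at_top_imp_at_infinity
        filterlim_real_sequentially)
  then have "limsup (\<lambda>n. ereal (ln L + ln b / real n)) = ereal (ln L)"
    by (intro lim_imp_Limsup) auto
  finally show "separation_rate f {0..1} \<epsilon> \<le> ereal (ln L)" .
qed

lemma lipschitz_conjugate_ge_1:
  fixes f \<psi> \<psi>' :: "real \<Rightarrow> real"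
  assumes cont: "continuous_on {0..1} f" and maps: "f ` {0..1} \<subseteq> {0..1}"
    and core: "\<not> is_singleton (\<Inter>i::nat. (f ^^ i) ` {0..1})"
    and hom: "homeomorphism {0..1} {0..1} \<psi> \<psi>'"
    and lip: "L-lipschitz_on {0..1} (\<psi> \<circ> f \<circ> \<psi>')"
  shows "1 \<le> L"
proof (rule ccontr)
  assume "\<not> 1 \<le> L"
  have "0 \<le> L" using lip lipschitz_on_nonneg by blast
  obtain p where p: "p \<in> {0..1}" "f p = p"
    using brouwer[OF compact_Icc convex_real_interval(5) _ cont] maps
    by (metis atLeastAtMost_iff empty_iff image_subset_iff_funcset order_refl zero_le_one)
  have "(f ^^ i) p = p" for i by (induction i) (auto simp: p)
  then have pin: "p \<in> (\<Inter>i::nat. (f ^^ i) ` {0..1})"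
    using p(1) by (metis INT_I imageI)
  have "q = p" if q: "q \<in> (\<Inter>i::nat. (f ^^ i) ` {0..1})" for q
  proof -
    have q01: "q \<in> {0..1}" using INT_D[OF q, of 0] by simp
    have "dist (\<psi> q) (\<psi> p) \<le> L ^ i" for i
    proof -
      obtain x where x: "x \<in> {0..1}" "(f ^^ i) x = q"
        using INT_D[OF q UNIV_I, of i] by (elim imageE) simp
      have in01: "\<psi> x \<in> {0..1}" "\<psi> p \<in> {0..1}"
        using hom x(1) p(1) unfolding homeomorphism_def by blast+
      have "dist (\<psi> q) (\<psi> p) \<le> L ^ i * dist (\<psi> x) (\<psi> p)"
        using dist_funpow_lipschitz[OF lip conjugate_image_subset[OF hom maps] in01, of i]
          conjugate_funpow[OF hom maps x(1)] conjugate_funpow[OF hom maps p(1)]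
          x(2) \<open>(f ^^ i) p = p\<close> by simp
      also have "\<dots> \<le> L ^ i * 1"
        using in01 \<open>0 \<le> L\<close> by (intro mult_left_mono) (auto simp: dist_real_def)
      finally show ?thesis by simp
    qed
    moreover have "(\<lambda>i. L ^ i) \<longlonglongrightarrow> 0"
      using \<open>0 \<le> L\<close> \<open>\<not> 1 \<le> L\<close> by (intro LIMSEQ_realpow_zero) auto
    ultimately have "dist (\<psi> q) (\<psi> p) \<le> 0"
      by (intro LIMSEQ_le_const) auto
    then have "\<psi>' (\<psi> q) = \<psi>' (\<psi> p)" by simp
    then show "q = p" using hom q01 p(1) unfolding homeomorphism_def by simp
  qed
  then have "(\<Inter>i::nat. (f ^^ i) ` {0..1}) = {p}" using pin by blast
  then show False using core by (metis is_singletonI)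
qed

section \<open>Counting itineraries\<close>

fun itinerary :: "('a \<Rightarrow> 'b) \<Rightarrow> ('a \<Rightarrow> 'a) \<Rightarrow> nat \<Rightarrow> 'a \<Rightarrow> 'b list" where
  "itinerary P f 0 x = []"
| "itinerary P f (Suc n) x = P x # itinerary P f n (f x)"

lemma itinerary_eq_iff:
  "itinerary P f n x = itinerary P f n y \<longleftrightarrow> (\<forall>i<n. P ((f ^^ i) x) = P ((f ^^ i) y))"
  by (induction n arbitrary: x y) (auto simp: All_less_Suc2 funpow_swap1)

lemma finite_itinerary_image:
  assumes "finite (P ` X)" "f ` X \<subseteq> X"
  shows "finite (itinerary P f n ` X)"
proof (induction n)
  case (Suc n)
  have "itinerary P f (Suc n) ` X \<subseteq> (\<lambda>(a, w). a # w) ` (P ` X \<times> itinerary P f n ` X)"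
    using assms(2) by auto
  then show ?case using Suc assms(1) finite_subset by blast
qed (simp add: image_constant_conv)

lemma card_image_le_card_image:
  assumes "finite (h ` A)" "\<And>x y. x \<in> A \<Longrightarrow> y \<in> A \<Longrightarrow> h x = h y \<Longrightarrow> g x = g y"
  shows "card (g ` A) \<le> card (h ` A)"
proof -
  have "g x = g (inv_into A h (h x))" if "x \<in> A" for x
    using that by (intro assms(2)) (simp_all add: inv_into_into f_inv_into_f)
  then have "g ` A \<subseteq> (\<lambda>w. g (inv_into A h w)) ` h ` A"
    by auto
  then show ?thesis
    using assms(1) by (rule surj_card_le[rotated])
qed

lemma finite_set_gap:
  fixes D :: "'a::metric_space set"
  assumes "finite D"
  obtains \<eta> where "\<eta> > 0" "\<And>d d'. d \<in> D \<Longrightarrow> d' \<in> D \<Longrightarrow> dist d d' < \<eta> \<Longrightarrow> d = d'"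
proof -
  define S where "S = insert 1 ((\<lambda>(d, d'). dist d d') ` {p \<in> D \<times> D. fst p \<noteq> snd p})"
  have "finite S" "S \<noteq> {}" using assms by (auto simp: S_def)
  moreover have "\<forall>s\<in>S. s > 0" by (auto simp: S_def)
  ultimately have "Min S > 0" by simp
  moreover have "d = d'" if "d \<in> D" "d' \<in> D" "dist d d' < Min S" for d d'
  proof (rule ccontr)
    assume "d \<noteq> d'"
    then have "dist d d' \<in> S" using that by (force simp: S_def)
    then show False using that(3) Min_le[OF \<open>finite S\<close>] by fastforce
  qed
  ultimately show thesis using that by blast
qed

lemma interval_partition_local_card:
  fixes Q :: "real \<Rightarrow> 'b"
  assumes fin: "finite (Q ` {0..1})"
    and conv: "\<And>x y z. 0 \<le> x \<Longrightarrow> x \<le> y \<Longrightarrow> y \<le> z \<Longrightarrow> z \<le> 1 \<Longrightarrow> Q x = Q z \<Longrightarrow> Q y = Q x"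
  obtains \<eta> where "\<eta> > 0"
    "\<And>J. J \<subseteq> {0..1} \<Longrightarrow> (\<And>x y. x \<in> J \<Longrightarrow> y \<in> J \<Longrightarrow> dist x y < \<eta>) \<Longrightarrow> card (Q ` J) \<le> 3"
proof -
  define D where "D = (\<lambda>w. Sup {x \<in> {0..1}. Q x = w}) ` Q ` {0..1}"
  have jump: "\<exists>d\<in>D. x \<le> d \<and> d \<le> y"
    if xy: "0 \<le> x" "x \<le> y" "y \<le> 1" "Q x \<noteq> Q y" for x y
  proof -
    define C where "C = {t \<in> {0..1}. Q t = Q x}"
    have "t \<le> y" if "t \<in> C" for t
    proof (rule ccontr)
      assume "\<not> t \<le> y"
      then have "Q y = Q x" using that conv[of x y t] xy(1,2) by (simp add: C_def)
      then show False using xy(4) by simp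
    qed
    moreover have "x \<in> C" using xy by (simp add: C_def)
    ultimately have "x \<le> Sup C" "Sup C \<le> y"
      by (meson bdd_above.I cSup_upper, metis cSup_least empty_iff)
    moreover have "Sup C \<in> D" using xy by (auto simp: D_def C_def)
    ultimately show ?thesis by blast
  qed
  obtain \<eta> where "\<eta> > 0"
    and \<eta>: "\<And>d d'. d \<in> D \<Longrightarrow> d' \<in> D \<Longrightarrow> dist d d' < \<eta> \<Longrightarrow> d = d'"
    using finite_set_gap[of D] fin unfolding D_def by blast
  have "card (Q ` J) \<le> 3"
    if J: "J \<subseteq> {0..1}" and small: "\<And>x y. x \<in> J \<Longrightarrow> y \<in> J \<Longrightarrow> dist x y < \<eta>" for J
  proof -
    have jumpJ: "\<exists>d\<in>D. x \<le> d \<and> d \<le> y" if "x \<in> J" "y \<in> J" "x \<le> y" "Q x \<noteq> Q y" for x y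
      using jump[of x y] subsetD[OF J that(1)] subsetD[OF J that(2)] that by simp
    have uniq: "d' = d"
      if "x \<in> J" "y \<in> J" "d \<in> D" "x \<le> d" "d \<le> y" "x' \<in> J" "y' \<in> J" "d' \<in> D" "x' \<le> d'" "d' \<le> y'"
      for x y d x' y' d'
    proof (rule \<eta>)
      show "dist d' d < \<eta>"
        using small[OF \<open>x \<in> J\<close> \<open>y' \<in> J\<close>] small[OF \<open>x' \<in> J\<close> \<open>y \<in> J\<close>] that
        unfolding dist_real_def by linarith
    qed fact+
    obtain d where d: "\<And>x y. x \<in> J \<Longrightarrow> y \<in> J \<Longrightarrow> x \<le> y \<Longrightarrow> Q x \<noteq> Q y \<Longrightarrow> x \<le> d \<and> d \<le> y"
    proof (cases "\<exists>x\<in>J. \<exists>y\<in>J. \<exists>d\<in>D. x \<le> d \<and> d \<le> y")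
      case True
      then obtain x0 y0 d where d: "x0 \<in> J" "y0 \<in> J" "d \<in> D" "x0 \<le> d" "d \<le> y0" by blast
      show thesis
      proof (rule that[of d])
        fix x y assume xy: "x \<in> J" "y \<in> J" "x \<le> y" "Q x \<noteq> Q y"
        then obtain d' where d': "d' \<in> D" "x \<le> d'" "d' \<le> y" using jumpJ by blast
        then show "x \<le> d \<and> d \<le> y" using uniq[OF d xy(1,2)] by blast
      qed
    next
      case False
      then show thesis using jumpJ that[of 0] by blast
    qed
    have fin': "finite (Q ` A)" if "A \<subseteq> J" for A
      using finite_subset[OF _ fin] that J by (meson image_mono subset_trans)
    have one: "card (Q ` A) \<le> 1"
      if A: "A \<subseteq> J" and eq: "\<And>x y. x \<in> A \<Longrightarrow> y \<in> A \<Longrightarrow> x \<le> y \<Longrightarrow> Q x = Q y" for A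
    proof -
      have "Q x = Q y" if "x \<in> A" "y \<in> A" for x y
        using eq[OF that] eq[OF that(2,1)] by (metis linear)
      then have "\<forall>u\<in>Q ` A. \<forall>w\<in>Q ` A. u = w" by blast
      then show ?thesis using card_le_Suc0_iff_eq[OF fin'[OF A]] unfolding One_nat_def by blast
    qed
    have "card (Q ` {x \<in> J. x < d}) \<le> 1"
      by (rule one) (blast, metis (no_types, lifting) d mem_Collect_eq not_le)
    moreover have "card (Q ` {x \<in> J. d < x}) \<le> 1"
      by (rule one) (blast, metis (no_types, lifting) d mem_Collect_eq not_le)
    moreover have "Q ` J \<subseteq> (Q ` {x \<in> J. x < d} \<union> Q ` {x \<in> J. d < x}) \<union> {Q d}"
    proof
      fix w assume "w \<in> Q ` J"
      then obtain x where "x \<in> J" "w = Q x" by blast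
      then show "w \<in> (Q ` {x \<in> J. x < d} \<union> Q ` {x \<in> J. d < x}) \<union> {Q d}"
        by (cases x d rule: linorder_cases) auto
    qed
    then have "card (Q ` J) \<le> card ((Q ` {x \<in> J. x < d} \<union> Q ` {x \<in> J. d < x}) \<union> {Q d})"
      using fin' by (intro card_mono) auto
    moreover have "\<dots> \<le> (card (Q ` {x \<in> J. x < d}) + card (Q ` {x \<in> J. d < x})) + card {Q d}"
      by (intro card_Un_le order_trans[OF card_Un_le] add_right_mono)
    ultimately show ?thesis by simp
  qed
  with \<open>\<eta> > 0\<close> show thesis using that by blast
qed

lemma card_itinerary_near:
  fixes F :: "'a::metric_space \<Rightarrow> 'a"
  assumes maps: "F ` X \<subseteq> X" and fin: "finite (Q ` X)"
    and loc: "\<And>J. J \<subseteq> X \<Longrightarrow> (\<And>x y. x \<in> J \<Longrightarrow> y \<in> J \<Longrightarrow> dist x y < \<eta>) \<Longrightarrow> card (Q ` J) \<le> r"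
  shows "B \<subseteq> X \<Longrightarrow> (\<And>i x y. i < n \<Longrightarrow> x \<in> B \<Longrightarrow> y \<in> B \<Longrightarrow> dist ((F ^^ i) x) ((F ^^ i) y) < \<eta>)
    \<Longrightarrow> card (itinerary Q F n ` B) \<le> r ^ n"
proof (induction n arbitrary: B)
  case 0
  then show ?case by (simp add: image_constant_conv)
next
  case (Suc n)
  have FB: "F ` B \<subseteq> X" using Suc.prems(1) maps by blast
  have "card (itinerary Q F n ` F ` B) \<le> r ^ n"
  proof (rule Suc.IH[OF FB])
    fix i x y assume "i < n" "x \<in> F ` B" "y \<in> F ` B"
    then obtain s t where "s \<in> B" "t \<in> B" "x = F s" "y = F t" by blast
    then show "dist ((F ^^ i) x) ((F ^^ i) y) < \<eta>"
      using Suc.prems(2)[of "Suc i" s t] \<open>i < n\<close> by (simp add: funpow_swap1)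
  qed
  moreover have "card (Q ` B) \<le> r"
    using Suc.prems(2)[of 0] by (intro loc[OF Suc.prems(1)]) auto
  ultimately have prod: "card (Q ` B \<times> itinerary Q F n ` F ` B) \<le> r ^ Suc n"
    by (simp add: card_cartesian_product mult_le_mono)
  have fin': "finite (Q ` B \<times> itinerary Q F n ` F ` B)"
    by (intro finite_cartesian_product finite_subset[OF image_mono[OF Suc.prems(1)] fin]
        finite_subset[OF image_mono[OF FB] finite_itinerary_image[OF fin maps]])
  have "itinerary Q F (Suc n) ` B \<subseteq> (\<lambda>(a, w). a # w) ` (Q ` B \<times> itinerary Q F n ` F ` B)"
    by auto
  then have "card (itinerary Q F (Suc n) ` B) \<le> card (Q ` B \<times> itinerary Q F n ` F ` B)"
    using fin' by (rule surj_card_le[rotated])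
  then show ?case using prod by (rule order_trans)
qed

lemma maximal_separated_set_spans:
  assumes bdd: "\<And>E. finite E \<Longrightarrow> E \<noteq> {} \<Longrightarrow> E \<subseteq> X \<Longrightarrow> separated_set f n \<epsilon> E \<Longrightarrow> card E \<le> b"
    and "X \<noteq> {}" "\<epsilon> \<ge> 0"
  obtains E where "finite E" "E \<noteq> {}" "E \<subseteq> X" "separated_set f n \<epsilon> E"
    "\<And>x. x \<in> X \<Longrightarrow> \<exists>y\<in>E. \<forall>i<n. dist ((f ^^ i) x) ((f ^^ i) y) \<le> \<epsilon>"
proof -
  define S where "S = (\<lambda>E. finite E \<and> E \<noteq> {} \<and> E \<subseteq> X \<and> separated_set f n \<epsilon> E)"
  obtain x0 where "x0 \<in> X" using \<open>X \<noteq> {}\<close> by blast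
  then have "S {x0}" by (simp add: S_def separated_set_def)
  then obtain E where E: "S E" and max: "\<And>E'. S E' \<Longrightarrow> card E' \<le> card E"
    using ex_has_greatest_nat[of S "{x0}" card "Suc b"] bdd unfolding S_def
    by (metis le_imp_less_Suc)
  have "\<exists>y\<in>E. \<forall>i<n. dist ((f ^^ i) x) ((f ^^ i) y) \<le> \<epsilon>" if "x \<in> X" for x
  proof (cases "x \<in> E")
    case True
    then show ?thesis using \<open>\<epsilon> \<ge> 0\<close> by (intro bexI[of _ x]) auto
  next
    case False
    show ?thesis
    proof (rule ccontr)
      assume "\<not> ?thesis"
      then have far: "\<exists>i<n. dist ((f ^^ i) x) ((f ^^ i) y) > \<epsilon>" if "y \<in> E" for y
        using that by force
      then have "S (insert x E)"
        using E \<open>x \<in> X\<close> by (auto simp: S_def separated_set_def dist_commute)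
      then show False using max[of "insert x E"] E False by (simp add: S_def)
    qed
  qed
  then show thesis using that E unfolding S_def by blast
qed

lemma card_itinerary_le_power_mult_card:
  fixes F :: "'a::metric_space \<Rightarrow> 'a"
  assumes maps: "F ` X \<subseteq> X" and fin: "finite (Q ` X)" and "\<eta> > 0"
    and loc: "\<And>J. J \<subseteq> X \<Longrightarrow> (\<And>x y. x \<in> J \<Longrightarrow> y \<in> J \<Longrightarrow> dist x y < \<eta>) \<Longrightarrow> card (Q ` J) \<le> r"
    and "finite E"
    and span: "\<And>x. x \<in> X \<Longrightarrow> \<exists>y\<in>E. \<forall>i<n. dist ((F ^^ i) x) ((F ^^ i) y) \<le> \<eta> / 3"
  shows "card (itinerary Q F n ` X) \<le> r ^ n * card E"
proof -
  define B where "B y = {x \<in> X. \<forall>i<n. dist ((F ^^ i) x) ((F ^^ i) y) \<le> \<eta> / 3}" for y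
  have "card (itinerary Q F n ` B y) \<le> r ^ n" for y
  proof (rule card_itinerary_near[OF maps fin loc])
    fix i x z assume "i < n" "x \<in> B y" "z \<in> B y"
    then have "dist ((F ^^ i) x) ((F ^^ i) y) \<le> \<eta> / 3" "dist ((F ^^ i) z) ((F ^^ i) y) \<le> \<eta> / 3"
      by (auto simp: B_def)
    then show "dist ((F ^^ i) x) ((F ^^ i) z) < \<eta>"
      using dist_triangle2[of "(F ^^ i) x" "(F ^^ i) z" "(F ^^ i) y"] \<open>\<eta> > 0\<close> by linarith
  qed (auto simp: B_def)
  then have "(\<Sum>y\<in>E. card (itinerary Q F n ` B y)) \<le> card E * r ^ n"
    using sum_bounded_above[of E _ "r ^ n"] by simp
  moreover have "itinerary Q F n ` X \<subseteq> (\<Union>y\<in>E. itinerary Q F n ` B y)"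
    using span by (fastforce simp: B_def)
  then have "card (itinerary Q F n ` X) \<le> card (\<Union>y\<in>E. itinerary Q F n ` B y)"
    using \<open>finite E\<close> finite_subset[OF image_mono finite_itinerary_image[OF fin maps]]
    by (intro card_mono finite_UN_I) (auto simp: B_def)
  moreover have "\<dots> \<le> (\<Sum>y\<in>E. card (itinerary Q F n ` B y))"
    using \<open>finite E\<close> by (rule card_UN_le)
  ultimately show ?thesis by (simp add: mult.commute)
qed

lemma topological_entropy_nonneg:
  fixes f :: "'a::metric_space \<Rightarrow> 'a"
  assumes "X \<noteq> {}"
  shows "0 \<le> topological_entropy f X"
proof -
  obtain x where "x \<in> X" using assms by blast
  have "0 \<le> (SUP E\<in>{E. finite E \<and> E \<noteq> {} \<and> E \<subseteq> X \<and> separated_set f n 1 E}.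
       ereal (ln (real (card E)) / real n))" for n
    by (rule SUP_upper2[of "{x}"]) (use \<open>x \<in> X\<close> in \<open>auto simp: separated_set_def\<close>)
  then have "0 \<le> separation_rate f X 1"
    unfolding separation_rate_def by (intro le_Limsup) auto
  also have "\<dots> \<le> topological_entropy f X"
    unfolding topological_entropy_def by (intro SUP_upper) auto
  finally show ?thesis .
qed

text \<open>An interval of small length meets at most three classes of a finite partition into intervals,
  so \<open>n\<close> steps of \<open>f ^^ k\<close> cost a factor \<open>3 ^ n\<close>; spread over \<open>n * k\<close> steps of \<open>f\<close> this is
  negligible for large \<open>k\<close>.\<close>

lemma itinerary_growth_le_entropy:
  fixes f :: "real \<Rightarrow> real"
  assumes maps: "f ` {0..1} \<subseteq> {0..1}" and finP: "finite (P ` {0..1})"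
    and conv: "\<And>n x y z. 0 \<le> x \<Longrightarrow> x \<le> y \<Longrightarrow> y \<le> z \<Longrightarrow> z \<le> 1
      \<Longrightarrow> itinerary P f n x = itinerary P f n z \<Longrightarrow> itinerary P f n y = itinerary P f n x"
    and ent: "topological_entropy f {0..1} < ereal a" and "0 \<le> a"
  obtains C where "\<forall>\<^sub>F m in sequentially. real (card (itinerary P f m ` {0..1})) \<le> C * exp a ^ m"
proof -
  define M where "M m = card (itinerary P f m ` {0..1})" for m
  obtain a' where a': "topological_entropy f {0..1} < ereal a'" "a' < a"
    using ereal_dense2[OF ent] by auto
  obtain k :: nat where "ln 3 / (a - a') < real k"
    using reals_Archimedean2 by blast
  then have k: "ln 3 < real k * (a - a')"
    using \<open>a' < a\<close> by (simp add: divide_simps)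
  moreover have "ln 3 > (0::real)" by simp
  ultimately have "k > 0"
    by (intro gr0I) auto
  have "3 = exp (ln (3::real))" by simp
  also have "\<dots> \<le> exp (real k * (a - a'))" using k by (simp only: exp_le_cancel_iff less_imp_le)
  finally have three: "3 \<le> exp (real k * (a - a'))" .
  define Q where "Q = itinerary P f k"
  define F where "F = f ^^ k"
  have mapsF: "F ` {0..1} \<subseteq> {0..1}"
    using funpow_image_subset[OF maps] by (auto simp: F_def image_subset_iff)
  have finQ: "finite (Q ` {0..1})"
    unfolding Q_def by (rule finite_itinerary_image[OF finP maps])
  obtain \<eta> where "\<eta> > 0" and \<eta>: "\<And>J. J \<subseteq> {0..1} \<Longrightarrow>
      (\<And>x y. x \<in> J \<Longrightarrow> y \<in> J \<Longrightarrow> dist x y < \<eta>) \<Longrightarrow> card (Q ` J) \<le> 3"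
    using interval_partition_local_card[OF finQ] conv unfolding Q_def by metis
  have "separation_rate f {0..1} (\<eta> / 3) \<le> topological_entropy f {0..1}"
    unfolding topological_entropy_def using \<open>\<eta> > 0\<close> by (intro SUP_upper) auto
  also note a'(1)
  finally have "separation_rate f {0..1} (\<eta> / 3) < ereal a'" .
  from Limsup_lessD[OF this[unfolded separation_rate_def]]
  obtain N where N: "\<And>n. n \<ge> N \<Longrightarrow>
      (SUP E\<in>{E. finite E \<and> E \<noteq> {} \<and> E \<subseteq> {0..1} \<and> separated_set f n (\<eta> / 3) E}.
        ereal (ln (real (card E)) / real n)) < ereal a'"
    unfolding eventually_sequentially by blast
  have block: "real (M (n * k)) \<le> exp a ^ (n * k)" if n: "n * k \<ge> N" "n > 0" for n
  proof -
    have card_sep: "real (card E) \<le> exp (real (n * k) * a')"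
      if E: "finite E" "E \<noteq> {}" "E \<subseteq> {0..1}" "separated_set f (n * k) (\<eta> / 3) E" for E
    proof -
      have "ereal (ln (real (card E)) / real (n * k)) < ereal a'"
        by (rule le_less_trans[OF SUP_upper N[OF n(1)]]) (use E in auto)
      then have "ln (real (card E)) / real (n * k) < a'" by simp
      then have "ln (real (card E)) < real (n * k) * a'"
        using n(2) \<open>k > 0\<close> by (simp add: divide_simps mult.commute)
      moreover have "0 < real (card E)" using E(1,2) by (simp add: card_gt_0_iff)
      ultimately show ?thesis by (metis exp_less_cancel_iff exp_ln less_imp_le)
    qed
    have "{0..1::real} \<noteq> {}" "0 \<le> \<eta> / 3" using \<open>\<eta> > 0\<close> by auto
    obtain E where E: "finite E" "E \<noteq> {}" "E \<subseteq> {0..1}" "separated_set f (n * k) (\<eta> / 3) E"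
      and span: "\<And>x. x \<in> {0..1} \<Longrightarrow> \<exists>y\<in>E. \<forall>i<n * k. dist ((f ^^ i) x) ((f ^^ i) y) \<le> \<eta> / 3"
    proof (rule maximal_separated_set_spans[OF _ \<open>{0..1::real} \<noteq> {}\<close> \<open>0 \<le> \<eta> / 3\<close>,
          of f "n * k" "nat \<lfloor>exp (real (n * k) * a')\<rfloor>"])
      fix E assume "finite E" "E \<noteq> {}" "E \<subseteq> {0..1}" "separated_set f (n * k) (\<eta> / 3) E"
      from card_sep[OF this] show "card E \<le> nat \<lfloor>exp (real (n * k) * a')\<rfloor>"
        by (rule le_nat_floor)
    qed (rule that)
    have "k * j < n * k" if "j < n" for j
      using that \<open>k > 0\<close> by (simp add: mult.commute)
    then have "\<exists>y\<in>E. \<forall>j<n. dist ((F ^^ j) x) ((F ^^ j) y) \<le> \<eta> / 3" if "x \<in> {0..1}" for x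
      unfolding F_def funpow_mult using span[OF that] by blast
    then have "card (itinerary Q F n ` {0..1}) \<le> 3 ^ n * card E"
      by (intro card_itinerary_le_power_mult_card[OF mapsF finQ \<open>\<eta> > 0\<close> \<eta> E(1)])
    moreover have "M (n * k) \<le> card (itinerary Q F n ` {0..1})"
      unfolding M_def
    proof (rule card_image_le_card_image)
      show "finite (itinerary Q F n ` {0..1})" by (rule finite_itinerary_image[OF finQ mapsF])
      fix x y assume "itinerary Q F n x = itinerary Q F n y"
      then have eq: "P ((f ^^ i) ((f ^^ (k * j)) x)) = P ((f ^^ i) ((f ^^ (k * j)) y))"
        if "j < n" "i < k" for i j
        using that by (simp add: itinerary_eq_iff Q_def F_def funpow_mult)
      show "itinerary P f (n * k) x = itinerary P f (n * k) y"
        unfolding itinerary_eq_iff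
      proof (intro allI impI)
        fix m assume "m < n * k"
        then have "m div k < n" "m mod k < k"
          using \<open>k > 0\<close> by (auto simp: less_mult_imp_div_less)
        moreover have "(f ^^ m) z = (f ^^ (m mod k)) ((f ^^ (k * (m div k))) z)" for z
          using funpow_add[of "m mod k" "k * (m div k)" f] by simp
        ultimately show "P ((f ^^ m) x) = P ((f ^^ m) y)" using eq by simp
      qed
    qed
    ultimately have "M (n * k) \<le> 3 ^ n * card E" by simp
    then have "real (M (n * k)) \<le> 3 ^ n * real (card E)"
      by (metis of_nat_mono of_nat_mult of_nat_numeral of_nat_power)
    also have "\<dots> \<le> exp (real k * (a - a')) ^ n * exp (real (n * k) * a')"
      using three card_sep[OF E] by (intro mult_mono power_mono) auto
    also have "\<dots> = exp a ^ (n * k)"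
      by (simp add: algebra_simps flip: exp_of_nat_mult exp_add)
    finally show ?thesis .
  qed
  have "real (M m) \<le> exp a ^ k * exp a ^ m" if "m \<ge> N" for m
  proof -
    define n where "n = m div k + 1"
    have "m < n * k" unfolding n_def using dividend_less_div_times[OF \<open>k > 0\<close>, of m] by simp
    moreover have "n * k \<le> m + k" by (simp add: n_def)
    moreover have "n > 0" by (simp add: n_def)
    moreover have "M m \<le> M (n * k)"
      unfolding M_def using \<open>m < n * k\<close>
      by (intro card_image_le_card_image finite_itinerary_image[OF finP maps])
        (auto simp: itinerary_eq_iff)
    ultimately have "real (M m) \<le> exp a ^ (n * k)" using block[of n] that by linarith
    also have "\<dots> \<le> exp a ^ (m + k)"
      using \<open>n * k \<le> m + k\<close> \<open>0 \<le> a\<close> by (intro power_increasing) auto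
    finally show ?thesis by (simp add: power_add mult.commute)
  qed
  then have "\<forall>\<^sub>F m in sequentially. real (M m) \<le> exp a ^ k * exp a ^ m"
    unfolding eventually_sequentially by blast
  then show thesis using that unfolding M_def by blast
qed

section \<open>Iterated variation functions\<close>

locale piecewise_monotone_map =
  fixes f :: "real \<Rightarrow> real" and k :: nat and c :: "nat \<Rightarrow> real"
  assumes cont: "continuous_on {0..1} f" and maps: "f ` {0..1} \<subseteq> {0..1}"
    and c_0: "c 0 = 0" and c_k: "c k = 1" and c_less: "\<And>i. i < k \<Longrightarrow> c i < c (Suc i)"
    and monotone_piece:
      "\<And>i. i < k \<Longrightarrow> mono_on {c i..c (Suc i)} f \<or> antimono_on {c i..c (Suc i)} f"
begin

lemma c_mono: "i \<le> j \<Longrightarrow> j \<le> k \<Longrightarrow> c i \<le> c j"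
proof (induction j rule: dec_induct)
  case (step n)
  then show ?case using c_less[of n] by simp
qed simp

lemma c_bounds: "i \<le> k \<Longrightarrow> 0 \<le> c i" "i \<le> k \<Longrightarrow> c i \<le> 1"
  using c_mono[of 0 i] c_mono[of i k] c_0 c_k by auto

lemma f_bounds: "x \<in> {0..1} \<Longrightarrow> f x \<in> {0..1}"
  using maps by blast

definition clamp :: "nat \<Rightarrow> real \<Rightarrow> real" where
  "clamp i x = max (c i) (min x (c (Suc i)))"

lemma clamp_piece: "i < k \<Longrightarrow> clamp i x \<in> {c i..c (Suc i)}"
  using c_less[of i] by (auto simp: clamp_def)

lemma clamp_bounds: "i < k \<Longrightarrow> clamp i x \<in> {0..1}"
  using clamp_piece[of i x] c_bounds[of i] c_bounds[of "Suc i"] by auto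

lemma clamp_mono: "x \<le> y \<Longrightarrow> clamp i x \<le> clamp i y"
  by (auto simp: clamp_def)

lemma clamp_id: "x \<in> {c i..c (Suc i)} \<Longrightarrow> clamp i x = x"
  by (auto simp: clamp_def)

lemma clamp_eq:
  assumes "i < k" "j < k" "i \<noteq> j" "x \<in> {c j..c (Suc j)}" "y \<in> {c j..c (Suc j)}"
  shows "clamp i x = clamp i y"
proof (cases "i < j")
  case True
  then show ?thesis using c_mono[of "Suc i" j] assms by (auto simp: clamp_def)
next
  case False
  then show ?thesis using c_mono[of "Suc j" i] assms by (auto simp: clamp_def)
qed

lemma clamp_0: "i < k \<Longrightarrow> clamp i 0 = c i"
  using c_bounds(1)[of i] by (auto simp: clamp_def)

lemma continuous_on_clamp: "continuous_on S (clamp i)"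
  unfolding clamp_def by (intro continuous_intros)

lemma sum_clamp:
  fixes w :: "real \<Rightarrow> real"
  assumes "x \<in> {0..1}"
  shows "(\<Sum>i<k. w (clamp i x) - w (c i)) = w x - w 0"
proof -
  have "(\<Sum>i<j. w (clamp i x) - w (c i)) = w (min x (c j)) - w 0" if "j \<le> k" for j
    using that
  proof (induction j)
    case 0
    then show ?case using assms by (simp add: c_0 min_absorb2)
  next
    case (Suc j)
    then show ?case
      using c_less[of j] by (auto simp: clamp_def min_def max_def)
  qed
  then show ?thesis using assms by (simp add: c_k min_def)
qed

text \<open>Since \<open>iterated_variation n \<circ> f\<close> is monotone on each piece, the sum below is its total
  variation on \<open>[0, x]\<close>.\<close>

primrec iterated_variation :: "nat \<Rightarrow> real \<Rightarrow> real" where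
  "iterated_variation 0 x = x"
| "iterated_variation (Suc n) x =
     (\<Sum>i<k. \<bar>iterated_variation n (f (clamp i x)) - iterated_variation n (f (c i))\<bar>)"

lemma iterated_variation_0: "iterated_variation n 0 = 0"
  by (cases n) (simp_all add: clamp_0)

lemma continuous_on_iterated_variation: "continuous_on {0..1} (iterated_variation n)"
proof (induction n)
  case (Suc n)
  have "continuous_on {0..1} (\<lambda>x. iterated_variation n (f (clamp i x)))" if "i < k" for i
    by (rule continuous_on_compose2[OF Suc continuous_on_compose2[OF cont continuous_on_clamp]])
      (use clamp_bounds[OF that] f_bounds in auto)
  then show ?case by (auto intro!: continuous_intros)
qed (simp add: continuous_on_id)

lemma iterated_variation_Suc_diff_aux:
  assumes mono: "mono_on {0..1} (iterated_variation n)" and "x \<le> y"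
  shows "iterated_variation (Suc n) y - iterated_variation (Suc n) x =
    (\<Sum>i<k. \<bar>iterated_variation n (f (clamp i y)) - iterated_variation n (f (clamp i x))\<bar>)"
proof -
  define w where "w = (\<lambda>x. iterated_variation n (f x))"
  have "\<bar>w (clamp i y) - w (c i)\<bar> - \<bar>w (clamp i x) - w (c i)\<bar> = \<bar>w (clamp i y) - w (clamp i x)\<bar>"
    if "i < k" for i
  proof -
    have piece: "{c i..c (Suc i)} \<subseteq> {0..1}"
      using that c_bounds[of i] c_bounds[of "Suc i"] by auto
    have pts: "c i \<in> {c i..c (Suc i)}" "clamp i x \<in> {c i..c (Suc i)}" "clamp i y \<in> {c i..c (Suc i)}"
      "c i \<le> clamp i x" "clamp i x \<le> clamp i y"
      using that c_less[of i] clamp_piece clamp_mono[OF \<open>x \<le> y\<close>] by auto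
    have inc: "w s \<le> w t"
      if "f s \<le> f t" "s \<in> {c i..c (Suc i)}" "t \<in> {c i..c (Suc i)}" for s t
      unfolding w_def using that piece by (intro mono_onD[OF mono] f_bounds) auto
    from monotone_piece[OF \<open>i < k\<close>]
    have "w (c i) \<le> w (clamp i x) \<and> w (clamp i x) \<le> w (clamp i y) \<or>
      w (clamp i y) \<le> w (clamp i x) \<and> w (clamp i x) \<le> w (c i)"
    proof
      assume f: "mono_on {c i..c (Suc i)} f"
      show ?thesis using inc mono_onD[OF f] pts by blast
    next
      assume f: "antimono_on {c i..c (Suc i)} f"
      show ?thesis using inc monotone_onD[OF f] pts by blast
    qed
    then show ?thesis by auto
  qed
  then show ?thesis by (simp add: w_def flip: sum_subtractf)
qed

lemma mono_iterated_variation: "mono_on {0..1} (iterated_variation n)"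
proof (induction n)
  case 0
  then show ?case by (auto intro: mono_onI)
next
  case (Suc n)
  show ?case
  proof (rule mono_onI)
    fix x y :: real assume "x \<le> y"
    have "0 \<le> iterated_variation (Suc n) y - iterated_variation (Suc n) x"
      unfolding iterated_variation_Suc_diff_aux[OF Suc \<open>x \<le> y\<close>] by (intro sum_nonneg) auto
    then show "iterated_variation (Suc n) x \<le> iterated_variation (Suc n) y" by simp
  qed
qed

lemmas iterated_variation_Suc_diff = iterated_variation_Suc_diff_aux[OF mono_iterated_variation]

lemma iterated_variation_le: "x \<in> {0..1} \<Longrightarrow> y \<in> {0..1} \<Longrightarrow> x \<le> y \<Longrightarrow>
    iterated_variation n x \<le> iterated_variation n y"
  by (rule mono_onD[OF mono_iterated_variation])

lemma abs_iterated_variation_image_le: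
  assumes "x \<in> {0..1}" "y \<in> {0..1}" "x \<le> y"
  shows "\<bar>iterated_variation n (f y) - iterated_variation n (f x)\<bar>
    \<le> iterated_variation (Suc n) y - iterated_variation (Suc n) x"
proof -
  define w where "w = (\<lambda>x. iterated_variation n (f x))"
  have "w y - w x = (\<Sum>i<k. w (clamp i y) - w (clamp i x))"
    using sum_clamp[of y w] sum_clamp[of x w] assms by (simp add: sum_subtractf)
  then have "\<bar>w y - w x\<bar> \<le> (\<Sum>i<k. \<bar>w (clamp i y) - w (clamp i x)\<bar>)" by simp
  then show ?thesis unfolding iterated_variation_Suc_diff[OF assms(3)] by (simp add: w_def)
qed

lemma iterated_variation_Suc_same_piece:
  assumes "j < k" "x \<in> {c j..c (Suc j)}" "y \<in> {c j..c (Suc j)}"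
  shows "\<bar>iterated_variation (Suc n) y - iterated_variation (Suc n) x\<bar> =
    \<bar>iterated_variation n (f y) - iterated_variation n (f x)\<bar>"
proof -
  have *: "iterated_variation (Suc n) y - iterated_variation (Suc n) x =
    \<bar>iterated_variation n (f y) - iterated_variation n (f x)\<bar>"
    if "x \<le> y" "x \<in> {c j..c (Suc j)}" "y \<in> {c j..c (Suc j)}" for x y
  proof -
    have "\<bar>iterated_variation n (f (clamp i y)) - iterated_variation n (f (clamp i x))\<bar> =
      (if i = j then \<bar>iterated_variation n (f y) - iterated_variation n (f x)\<bar> else 0)"
      if "i < k" for i
      using clamp_eq[OF that \<open>j < k\<close> _ \<open>x \<in> _\<close> \<open>y \<in> _\<close>] clamp_id \<open>x \<in> _\<close> \<open>y \<in> _\<close> by auto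
    then show ?thesis
      unfolding iterated_variation_Suc_diff[OF \<open>x \<le> y\<close>] using \<open>j < k\<close> by simp
  qed
  show ?thesis
    using *[of x y] *[of y x] assms(2,3) by (cases "x \<le> y") (auto simp: abs_minus_commute)
qed

text \<open>Two points have the same index iff they lie in the same one of the intervals
  \<open>[c 0, c 1], (c 1, c 2], \<dots>, (c (k - 1), c k]\<close>.\<close>

definition piece_index :: "real \<Rightarrow> nat set" where
  "piece_index x = {i. i < k \<and> c (Suc i) < x}"

lemma finite_piece_index_image: "finite (piece_index ` S)"
  by (rule finite_subset[of _ "Pow {..<k}"]) (auto simp: piece_index_def)

lemma same_piece:
  assumes "x \<in> {0..1}" "y \<in> {0..1}" "piece_index x = piece_index y"
  obtains i where "i < k" "x \<in> {c i..c (Suc i)}" "y \<in> {c i..c (Suc i)}"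
proof -
  have "k > 0" using c_0 c_k by (cases k) auto
  then have last: "k - 1 \<notin> piece_index x" using assms(1) c_k by (auto simp: piece_index_def)
  define i where "i = (LEAST i. i \<notin> piece_index x)"
  have "i \<notin> piece_index x" unfolding i_def using last by (rule LeastI)
  have "i \<le> k - 1" unfolding i_def using last by (rule Least_le)
  then have "i < k" using \<open>k > 0\<close> by simp
  have "c i \<le> x \<and> c i \<le> y"
  proof (cases i)
    case 0
    then show ?thesis using c_0 assms(1,2) by simp
  next
    case (Suc j)
    then have "j \<in> piece_index x"
      using not_less_Least[of j "\<lambda>i. i \<notin> piece_index x"] unfolding i_def by simp
    moreover from this have "j \<in> piece_index y" by (simp only: assms(3))
    ultimately show ?thesis using Suc by (simp add: piece_index_def)
  qed
  moreover have "x \<le> c (Suc i) \<and> y \<le> c (Suc i)"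
    using \<open>i \<notin> piece_index x\<close> \<open>i \<notin> piece_index x\<close>[unfolded assms(3)] \<open>i < k\<close>
    by (simp add: piece_index_def not_less)
  ultimately show thesis using that \<open>i < k\<close> by auto
qed

lemma itinerary_between:
  "0 \<le> x \<Longrightarrow> x \<le> y \<Longrightarrow> y \<le> z \<Longrightarrow> z \<le> 1 \<Longrightarrow>
    itinerary piece_index f n x = itinerary piece_index f n z \<Longrightarrow>
    itinerary piece_index f n y = itinerary piece_index f n x"
proof (induction n arbitrary: x y z)
  case (Suc n)
  have in01: "x \<in> {0..1}" "y \<in> {0..1}" "z \<in> {0..1}" using Suc.prems by auto
  have eq: "piece_index x = piece_index z"
    "itinerary piece_index f n (f x) = itinerary piece_index f n (f z)"
    using Suc.prems by auto
  have "piece_index x \<subseteq> piece_index y" "piece_index y \<subseteq> piece_index z"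
    using Suc.prems(2,3) by (auto simp: piece_index_def)
  then have "piece_index y = piece_index x" using eq(1) by blast
  moreover obtain i where i: "i < k" "x \<in> {c i..c (Suc i)}" "z \<in> {c i..c (Suc i)}"
    using same_piece[OF in01(1,3) eq(1)] by blast
  then have y: "y \<in> {c i..c (Suc i)}" using Suc.prems(2,3) by auto
  from monotone_piece[OF i(1)]
  have "itinerary piece_index f n (f y) = itinerary piece_index f n (f x)"
  proof
    assume "mono_on {c i..c (Suc i)} f"
    then have "f x \<le> f y" "f y \<le> f z"
      using i y Suc.prems(2,3) by (auto intro: mono_onD)
    then show ?thesis using Suc.IH[of "f x" "f y" "f z"] f_bounds in01 eq(2) by auto
  next
    assume f: "antimono_on {c i..c (Suc i)} f"
    have "f y \<le> f x" "f z \<le> f y"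
      using monotone_onD[OF f i(2) y Suc.prems(2)] monotone_onD[OF f y i(3) Suc.prems(3)] by simp_all
    then show ?thesis using Suc.IH[of "f z" "f y" "f x"] f_bounds in01 eq(2) by auto
  qed
  ultimately show ?case by simp
qed simp

lemma iterated_variation_same_itinerary:
  "x \<in> {0..1} \<Longrightarrow> y \<in> {0..1} \<Longrightarrow> itinerary piece_index f n x = itinerary piece_index f n y \<Longrightarrow>
    \<bar>iterated_variation n y - iterated_variation n x\<bar> = \<bar>(f ^^ n) y - (f ^^ n) x\<bar>"
proof (induction n arbitrary: x y)
  case (Suc n)
  then obtain i where "i < k" "x \<in> {c i..c (Suc i)}" "y \<in> {c i..c (Suc i)}"
    using same_piece[of x y] by auto
  then have "\<bar>iterated_variation (Suc n) y - iterated_variation (Suc n) x\<bar> =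
      \<bar>iterated_variation n (f y) - iterated_variation n (f x)\<bar>"
    by (rule iterated_variation_Suc_same_piece)
  also have "\<dots> = \<bar>(f ^^ n) (f y) - (f ^^ n) (f x)\<bar>"
    using Suc.prems by (intro Suc.IH f_bounds) auto
  finally show ?case by (simp add: funpow_swap1)
qed simp

lemma iterated_variation_1_le:
  "iterated_variation n 1 \<le> 2 * real (card (itinerary piece_index f n ` {0..1}))"
proof (rule ccontr)
  define N where "N = card (itinerary piece_index f n ` {0..1})"
  assume "\<not> iterated_variation n 1 \<le> 2 * real (card (itinerary piece_index f n ` {0..1}))"
  then have big: "2 * real N < iterated_variation n 1" by (simp add: N_def)
  have "\<exists>x\<in>{0..1}. iterated_variation n x = 2 * real j" if "j \<le> N" for j
    using IVT'[OF _ _ _ continuous_on_iterated_variation, of n "2 * real j"]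
      iterated_variation_0[of n] that big by fastforce
  then obtain t where t: "\<And>j. j \<le> N \<Longrightarrow> t j \<in> {0..1} \<and> iterated_variation n (t j) = 2 * real j"
    by metis
  have "inj_on (\<lambda>j. itinerary piece_index f n (t j)) {..N}"
  proof (rule inj_onI)
    fix i j assume ij: "i \<in> {..N}" "j \<in> {..N}"
      and eq: "itinerary piece_index f n (t i) = itinerary piece_index f n (t j)"
    have in01: "t i \<in> {0..1}" "t j \<in> {0..1}" using t ij by auto
    have "\<bar>2 * real j - 2 * real i\<bar> = \<bar>(f ^^ n) (t j) - (f ^^ n) (t i)\<bar>"
      using iterated_variation_same_itinerary[OF in01 eq] t ij by simp
    also have "\<dots> \<le> 1"
      using funpow_image_subset[OF maps in01(1), of n] funpow_image_subset[OF maps in01(2), of n]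
      by auto
    finally show "i = j" by linarith
  qed
  then have "card {..N} \<le> card (itinerary piece_index f n ` {0..1})"
    using t finite_itinerary_image[OF finite_piece_index_image maps]
    by (intro card_inj_on_le) auto
  then show False by (simp add: N_def)
qed

lemma lipschitz_conjugate:
  assumes "L > 0" and summ: "summable (\<lambda>n. iterated_variation n 1 / L ^ n)"
  obtains \<psi> \<psi>' :: "real \<Rightarrow> real"
    where "homeomorphism {0..1} {0..1} \<psi> \<psi>'" "L-lipschitz_on {0..1} (\<psi> \<circ> f \<circ> \<psi>')"
proof -
  define v where "v n x = iterated_variation n x / L ^ n" for n x
  define \<phi> where "\<phi> x = (\<Sum>n. v n x)" for x
  have v_mono: "v n x \<le> v n y" if "x \<in> {0..1}" "y \<in> {0..1}" "x \<le> y" for n x y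
    unfolding v_def using that \<open>L > 0\<close> by (intro divide_right_mono iterated_variation_le) auto
  have v_0: "v n 0 = 0" for n by (simp add: v_def iterated_variation_0)
  have v_bound: "norm (v n x) \<le> v n 1" if "x \<in> {0..1}" for n x
    using v_mono[of 0 x n] v_mono[of x 1 n] that v_0 by auto
  have summ1: "summable (\<lambda>n. v n 1)" using summ by (simp add: v_def)
  have summ_v: "summable (\<lambda>n. v n x)" if "x \<in> {0..1}" for x
    by (rule summable_comparison_test'[OF summ1 v_bound[OF that]])
  have diff: "\<phi> y - \<phi> x = (\<Sum>n. v n y - v n x)" if "x \<in> {0..1}" "y \<in> {0..1}" for x y
    unfolding \<phi>_def using that by (intro suminf_diff summ_v)
  have incr: "y - x \<le> \<phi> y - \<phi> x" if "x \<in> {0..1}" "y \<in> {0..1}" "x \<le> y" for x y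
  proof -
    have "(\<Sum>n\<in>{0}. v n y - v n x) \<le> (\<Sum>n. v n y - v n x)"
      using that v_mono by (intro sum_le_suminf summable_diff summ_v) auto
    then show ?thesis using diff that by (simp add: v_def)
  qed
  have "uniform_limit {0..1} (\<lambda>n x. \<Sum>i<n. v i x) \<phi> sequentially"
    unfolding \<phi>_def by (rule Weierstrass_m_test[OF v_bound summ1])
  then have cont_\<phi>: "continuous_on {0..1} \<phi>"
    using continuous_on_iterated_variation \<open>L > 0\<close>
    by (intro uniform_limit_theorem[of _ "\<lambda>n x. \<Sum>i<n. v i x" sequentially])
      (auto simp: v_def intro!: always_eventually continuous_intros)
  have "\<phi> 0 = 0" by (simp add: \<phi>_def v_0)
  then have "\<phi> 1 > 0" using incr[of 0 1] by simp
  define \<psi> where "\<psi> x = \<phi> x / \<phi> 1" for x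
  have cont_\<psi>: "continuous_on {0..1} \<psi>"
    unfolding \<psi>_def using cont_\<phi> \<open>\<phi> 1 > 0\<close> by (intro continuous_intros) auto
  have \<psi>_less: "\<psi> x < \<psi> y" if "x \<in> {0..1}" "y \<in> {0..1}" "x < y" for x y
    using incr[of x y] that \<open>\<phi> 1 > 0\<close> by (simp add: \<psi>_def divide_strict_right_mono)
  have ends: "\<psi> 0 = 0" "\<psi> 1 = 1" using \<open>\<phi> 0 = 0\<close> \<open>\<phi> 1 > 0\<close> by (auto simp: \<psi>_def)
  have inj: "inj_on \<psi> {0..1}"
    by (rule linorder_inj_onI) (use \<psi>_less in \<open>auto simp: less_imp_neq\<close>)
  have "\<psi> ` {0..1} = {0..1}"
  proof
    show "\<psi> ` {0..1} \<subseteq> {0..1}"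
    proof (rule image_subsetI)
      fix x :: real assume "x \<in> {0..1}"
      then show "\<psi> x \<in> {0..1}"
        using \<psi>_less[of 0 x] \<psi>_less[of x 1] ends by (cases "x = 0"; cases "x = 1") auto
    qed
    show "{0..1} \<subseteq> \<psi> ` {0..1}"
      using IVT'[OF _ _ _ cont_\<psi>] ends by fastforce
  qed
  then obtain \<psi>' where hom: "homeomorphism {0..1} {0..1} \<psi> \<psi>'"
    using homeomorphism_compact[OF compact_Icc cont_\<psi> _ inj] by blast
  have \<phi>_lip: "\<bar>\<phi> (f y) - \<phi> (f x)\<bar> \<le> L * (\<phi> y - \<phi> x)"
    if xy: "x \<in> {0..1}" "y \<in> {0..1}" "x \<le> y" for x y
  proof -
    have step: "\<bar>v n (f y) - v n (f x)\<bar> \<le> L * (v (Suc n) y - v (Suc n) x)" for n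
    proof -
      have "\<bar>v n (f y) - v n (f x)\<bar> = \<bar>iterated_variation n (f y) - iterated_variation n (f x)\<bar> / L ^ n"
        using \<open>L > 0\<close> by (simp add: v_def flip: diff_divide_distrib)
      also have "\<dots> \<le> (iterated_variation (Suc n) y - iterated_variation (Suc n) x) / L ^ n"
        using \<open>L > 0\<close> by (intro divide_right_mono abs_iterated_variation_image_le xy) auto
      also have "\<dots> = L * (v (Suc n) y - v (Suc n) x)"
        using \<open>L > 0\<close> by (simp add: v_def field_simps del: iterated_variation.simps)
      finally show ?thesis .
    qed
    have summ_d: "summable (\<lambda>n. v n y - v n x)" using xy by (intro summable_diff summ_v)
    then have summ_d': "summable (\<lambda>n. v (Suc n) y - v (Suc n) x)"
      by (subst summable_Suc_iff)
    have summ_abs: "summable (\<lambda>n. \<bar>v n (f y) - v n (f x)\<bar>)"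
      by (rule summable_comparison_test'[OF summable_mult[OF summ_d', of L], of 0]) (use step in simp)
    have "\<bar>\<phi> (f y) - \<phi> (f x)\<bar> = \<bar>\<Sum>n. v n (f y) - v n (f x)\<bar>"
      using diff f_bounds xy by simp
    also have "\<dots> \<le> (\<Sum>n. \<bar>v n (f y) - v n (f x)\<bar>)"
      by (rule summable_rabs[OF summ_abs])
    also have "\<dots> \<le> (\<Sum>n. L * (v (Suc n) y - v (Suc n) x))"
      by (intro suminf_le step summ_abs summable_mult summ_d')
    also have "\<dots> = L * (\<Sum>n. v (Suc n) y - v (Suc n) x)"
      by (rule suminf_mult[OF summ_d'])
    also have "(\<Sum>n. v (Suc n) y - v (Suc n) x) = (\<phi> y - \<phi> x) - (y - x)"
      using suminf_split_head[OF summ_d] diff xy by (simp add: v_def)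
    also have "L * (\<phi> y - \<phi> x - (y - x)) \<le> L * (\<phi> y - \<phi> x)"
      using xy \<open>L > 0\<close> by (intro mult_left_mono) auto
    finally show ?thesis .
  qed
  have \<psi>_lip: "\<bar>\<psi> (f y) - \<psi> (f x)\<bar> \<le> L * \<bar>\<psi> y - \<psi> x\<bar>" if "x \<in> {0..1}" "y \<in> {0..1}" for x y
  proof -
    have "\<bar>\<phi> (f y) - \<phi> (f x)\<bar> \<le> L * \<bar>\<phi> y - \<phi> x\<bar>"
      using \<phi>_lip[of x y] \<phi>_lip[of y x] incr[of x y] incr[of y x] that
      by (cases "x \<le> y") (auto simp: abs_minus_commute)
    then have "\<bar>\<phi> (f y) - \<phi> (f x)\<bar> / \<phi> 1 \<le> L * \<bar>\<phi> y - \<phi> x\<bar> / \<phi> 1"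
      using \<open>\<phi> 1 > 0\<close> by (intro divide_right_mono) auto
    then show ?thesis using \<open>\<phi> 1 > 0\<close> by (simp add: \<psi>_def flip: diff_divide_distrib)
  qed
  have "L-lipschitz_on {0..1} (\<psi> \<circ> f \<circ> \<psi>')"
  proof (rule lipschitz_onI)
    fix u w :: real assume "u \<in> {0..1}" "w \<in> {0..1}"
    then have "\<psi>' u \<in> {0..1}" "\<psi>' w \<in> {0..1}" "\<psi> (\<psi>' u) = u" "\<psi> (\<psi>' w) = w"
      using hom unfolding homeomorphism_def by blast+
    then show "dist ((\<psi> \<circ> f \<circ> \<psi>') u) ((\<psi> \<circ> f \<circ> \<psi>') w) \<le> L * dist u w"
      using \<psi>_lip[of "\<psi>' w" "\<psi>' u"] by (simp add: dist_real_def)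
  qed (use \<open>L > 0\<close> in simp)
  then show thesis using that hom by blast
qed

lemma conj_lipschitz_inf_le:
  assumes ent: "topological_entropy f {0..1} < ereal a" and "0 \<le> a" "exp a < L"
  shows "conj_lipschitz_inf f \<le> ereal L"
proof -
  have "L > 0" using \<open>exp a < L\<close> exp_gt_zero less_trans by blast
  obtain C where C: "\<forall>\<^sub>F m in sequentially.
      real (card (itinerary piece_index f m ` {0..1})) \<le> C * exp a ^ m"
    by (rule itinerary_growth_le_entropy[OF maps finite_piece_index_image _ ent \<open>0 \<le> a\<close>])
      (rule itinerary_between; assumption)
  have "summable (\<lambda>n. iterated_variation n 1 / L ^ n)"
  proof (rule summable_comparison_test_ev)
    show "summable (\<lambda>n. 2 * C * (exp a / L) ^ n)"
      using \<open>exp a < L\<close> \<open>L > 0\<close> by (intro summable_mult summable_geometric) auto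
    show "\<forall>\<^sub>F n in sequentially. norm (iterated_variation n 1 / L ^ n) \<le> 2 * C * (exp a / L) ^ n"
      using C
    proof eventually_elim
      case (elim n)
      have "0 \<le> iterated_variation n 1"
        using iterated_variation_le[of 0 1 n] iterated_variation_0[of n] by simp
      moreover have "iterated_variation n 1 \<le> 2 * C * exp a ^ n"
        using iterated_variation_1_le[of n] elim by simp
      ultimately show ?case
        using \<open>L > 0\<close> by (simp add: power_divide divide_right_mono)
    qed
  qed
  then obtain \<psi> \<psi>' :: "real \<Rightarrow> real"
    where "homeomorphism {0..1} {0..1} \<psi> \<psi>'" "L-lipschitz_on {0..1} (\<psi> \<circ> f \<circ> \<psi>')"
    using lipschitz_conjugate[OF \<open>L > 0\<close>] by blast
  then show ?thesis unfolding conj_lipschitz_inf_def by (intro Inf_lower imageI) blast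
qed

end

theorem corollary3p5:
  fixes f :: "real \<Rightarrow> real"
  assumes "continuous_on {0..1} f" and "f ` {0..1} \<subseteq> {0..1}"
    and "\<not> is_singleton (\<Inter>i::nat. (f ^^ i) ` {0..1})"
    and "piecewise_monotone f"
  shows "conj_lipschitz_inf f = exp_ereal (topological_entropy f {0..1})"
proof (rule antisym)
  obtain k :: nat and c where c: "c 0 = 0" "c k = 1" "\<And>i. i < k \<Longrightarrow> c i < c (Suc i)"
    "\<And>i. i < k \<Longrightarrow> mono_on {c i..c (Suc i)} f \<or> antimono_on {c i..c (Suc i)} f"
    using assms(4) unfolding piecewise_monotone_def by blast
  interpret piecewise_monotone_map f k c
    by unfold_locales (fact assms(1) assms(2) c)+
  have nonneg: "0 \<le> topological_entropy f {0..1}"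
    by (rule topological_entropy_nonneg) simp
  show "conj_lipschitz_inf f \<le> exp_ereal (topological_entropy f {0..1})"
  proof (rule ccontr)
    assume "\<not> ?thesis"
    then have "exp_ereal (topological_entropy f {0..1}) < conj_lipschitz_inf f" by simp
    then obtain L where L: "exp_ereal (topological_entropy f {0..1}) < ereal L"
      "ereal L < conj_lipschitz_inf f"
      using ereal_dense2 by blast
    have "exp_ereal \<infinity> = \<infinity>"
      using exp_ereal.simps(2) unfolding infinity_ereal_def .
    then obtain r where r: "topological_entropy f {0..1} = ereal r" "0 \<le> r"
      using nonneg L(1) by (cases "topological_entropy f {0..1}") auto
    then have "exp r < L" using L(1) by simp
    then obtain \<mu> where \<mu>: "exp r < \<mu>" "\<mu> < L" using dense by blast
    then have "\<mu> > 0" using exp_gt_zero less_trans by blast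
    then have "r < ln \<mu>" using \<mu>(1) by (metis exp_less_cancel_iff exp_ln)
    moreover from this have "0 \<le> ln \<mu>" using r(2) by simp
    ultimately have "conj_lipschitz_inf f \<le> ereal L"
      using r(1) \<mu>(2) \<open>\<mu> > 0\<close> by (intro conj_lipschitz_inf_le[of "ln \<mu>"]) simp_all
    then show False using L(2) by simp
  qed
  show "exp_ereal (topological_entropy f {0..1}) \<le> conj_lipschitz_inf f"
    unfolding conj_lipschitz_inf_def
  proof (rule INF_greatest, safe)
    fix L \<psi> \<psi>'
    assume hom: "homeomorphism {0..1} {0..1} \<psi> (\<psi>' :: real \<Rightarrow> real)"
      and lip: "L-lipschitz_on {0..1} (\<psi> \<circ> f \<circ> \<psi>')"
    have "1 \<le> L" by (rule lipschitz_conjugate_ge_1[OF assms(1-3) hom lip])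
    have "topological_entropy f {0..1} \<le> ereal (ln L)"
      by (rule topological_entropy_le_ln_lipschitz[OF hom lip assms(2) \<open>1 \<le> L\<close>])
    then obtain r where r: "topological_entropy f {0..1} = ereal r" "r \<le> ln L"
      using nonneg by (cases "topological_entropy f {0..1}") auto
    then have "exp r \<le> L" using \<open>1 \<le> L\<close> by (metis exp_le_cancel_iff exp_ln less_le_trans zero_less_one)
    then show "exp_ereal (topological_entropy f {0..1}) \<le> ereal L" using r by simp
  qed
qed

end
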